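(* Let $\Gamma \cup \{\varphi\}$ be a set of formulas over $\Sigma_\omega=\{\land,\vee,\to,\neg\}$. The following assertions are equivalent: (1) $\Gamma \vdash_{C_{min}} \varphi$; (2) $\Gamma \models_{\mathbb{HC}_{min}} \varphi$; (3) $\Gamma \models_{C_{min}}^{HSW} \varphi$.
   Context: Formulas: $For(\Sigma_\omega)$ is the free algebra over the signature $\Sigma_\omega=\{\land,\vee,\to,\neg\}$ ($\land,\vee,\to$ binary, $\neg$ unary) generated by denumerably many propositional variables $p_0,p_1,\dots$. Logic $C_{min}$: $\Gamma\vdash_{C_{min}}\varphi$ denotes derivability from $\Gamma$ in the Hilbert calculus with the single rule modus ponens and the axiom schemas: $\alpha\to(\beta\to\alpha)$; $(\alpha\to(\beta\to\gamma))\to((\alpha\to\beta)\to(\alpha\to\gamma))$; $\alpha\to(\beta\to(\alpha\land\beta))$; $(\alpha\land\beta)\to\alpha$; $(\alpha\land\beta)\to\beta$; $\alpha\to(\alpha\vee\beta)$; $\beta\to(\alpha\vee\beta)$; $(\alpha\to\gamma)\to((\beta\to\gamma)\to((\alpha\vee\beta)\to\gamma))$; $\alpha\vee\neg\alpha$; $\neg\neg\alpha\to\alpha$ (these define $C_\omega$); and, additionally, $\alpha\vee(\alpha\to\beta)$. Prosets: a proset is a non-empty set $P$ with a reflexive transitive relation $\preceq$. Write $x\equiv y$ if $x\preceq y$ and $y\preceq x$. For $A,B\subseteq P$: $A\preceq B$ means $a\preceq b$ for all $a\in A,b\in B$ (similarly with an element in place of a set); $A\equiv B$ means $a\equiv b$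 for all $a\in A,b\in B$. $\mathsf{Min}(B)=\{x\in B: x\preceq B\}$, $\mathsf{Max}(B)=\{x\in B: B\preceq x\}$; $\mathsf{Ub}(B)$, $\mathsf{Lb}(B)$ are the sets of upper and lower bounds of $B$ in $P$; $\top=\mathsf{Max}(P)$. Hyperoperations: an $n$-ary hyperoperation on $A$ is a map $A^n\to\wp(A)\setminus\{\emptyset\}$; a hyperalgebra over a signature is a set with a hyperoperation for each symbol. Hyperlattice: a proset in which $x\curlyvee y:=\mathsf{Min}(\mathsf{Ub}(\{x,y\}))$ and $x\curlywedge y:=\mathsf{Max}(\mathsf{Lb}(\{x,y\}))$ are non-empty for all $x,y$. A Sette implicative hyperlattice (IHL) is a hyperalgebra $\mathsf L=\langle L,\curlywedge,\curlyvee,\multimap\rangle$ such that $\langle L,\curlywedge,\curlyvee\rangle$ is a hyperlattice and, for all $x,y,z,z'$: $z\in x\multimap y$ implies $x\curlywedge z\preceq y$; $x\curlywedge z\preceq y$ implies $z\preceq x\multimap y$; $z\equiv z'$ and $z\in x\multimap y$ imply $z'\in x\multimap y$. A classical implicative hyperlattice (CIHL) is an IHL such that $z\in x\multimap y$ and $w\in x\curlyvee z$ imply $w\in\top$. HC$_{min}$A (hyper $C_{min}$ algebra): a hyperalgebra $\mathsf H=\langle H,\curlywedge,\curlyvee,\multimap,\div\rangle$ over $\Sigma_\omega$ (with $\land,\vee,\to,\neg$ interpreted as $\curlywedge,\curlyvee,\multimap,\div$) whose reduct $\langle H,\curlywedge,\curlyvee,\multimap\rangle$ is a CIHL and such that for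 all $x,y,w$: if $y\in\div x$ and $w\in x\curlyvee y$ then $w\in\top$; if $y\in\div x$ and $w\in\div y$ then $w\preceq x$. Nmatrices: an Nmatrix is a pair $\mathcal M=\langle\mathsf A,D\rangle$ with $\mathsf A$ a hyperalgebra over $\Sigma_\omega$ and $D\subseteq A$ the designated values. A valuation over $\mathcal M$ is a map $v:For(\Sigma_\omega)\to A$ with $v(\alpha\,\#\,\beta)\in v(\alpha)\,\tilde\#\,v(\beta)$ for each binary $\#$, and $v(\neg\alpha)\in\tilde\neg v(\alpha)$, where $\tilde\#,\tilde\neg$ are the interpretations in $\mathsf A$. $\Gamma\models_{\mathcal M}\varphi$ means: for every valuation $v$, if $v(\gamma)\in D$ for all $\gamma\in\Gamma$ then $v(\varphi)\in D$. $\Gamma\models_{\mathbb{HC}_{min}}\varphi$ means $\Gamma\models_{\langle\mathsf H,\top\rangle}\varphi$ for every HC$_{min}$A $\mathsf H$, where $\top=\mathsf{Max}(H)$. Hyper swap structures for $C_{min}$: for a CIHL $\mathsf L$, let $S^{C_\omega}_{\mathsf L}=\{z=(z_1,z_2)\in L\times L: z_1\curlyvee z_2\equiv\top\}$, and let $\mathsf S(\mathsf L)$ be the hyperalgebra with domain $S^{C_\omega}_{\mathsf L}$ and $z\curlywedge w=\{u: u_1\in z_1\curlywedge w_1\}$, $z\curlyvee w=\{u: u_1\in z_1\curlyvee w_1\}$, $z\multimap w=\{u: u_1\in z_1\multimap w_1\}$, $\div z=\{u: u_1=z_2\text{ and }u_2\preceq z_1\}$ ($u$ ranging over $S^{C_\omega}_{\mathsf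 L}$). Let $\mathcal M(\mathsf L)=\langle\mathsf S(\mathsf L),D^{C_\omega}_{\mathsf L}\rangle$ with $D^{C_\omega}_{\mathsf L}=\{z\in S^{C_\omega}_{\mathsf L}: z_1\in\top\}$. $\Gamma\models_{C_{min}}^{HSW}\varphi$ means $\Gamma\models_{\mathcal M(\mathsf L)}\varphi$ for every CIHL $\mathsf L$. *)

theory Defs
  imports "HOL-Library.Infinite_Typeclass"
begin

datatype fm =
    Var nat
  | Conj fm fm (infixr "\<^bold>\<and>" 75)
  | Disj fm fm (infixr "\<^bold>\<or>" 70)
  | Impl fm fm (infixr "\<^bold>\<rightarrow>" 65)
  | Neg fm ("\<^bold>\<not> _" [80] 80)

inductive Cmin_derives :: "fm set \<Rightarrow> fm \<Rightarrow> bool" (infix "\<turnstile>\<^sub>C" 50)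
  for \<Gamma> :: "fm set"
where
  hyp:   "\<gamma> \<in> \<Gamma> \<Longrightarrow> \<Gamma> \<turnstile>\<^sub>C \<gamma>"
| mp:    "\<Gamma> \<turnstile>\<^sub>C \<alpha> \<Longrightarrow> \<Gamma> \<turnstile>\<^sub>C \<alpha> \<^bold>\<rightarrow> \<beta> \<Longrightarrow> \<Gamma> \<turnstile>\<^sub>C \<beta>"
| K:     "\<Gamma> \<turnstile>\<^sub>C \<alpha> \<^bold>\<rightarrow> (\<beta> \<^bold>\<rightarrow> \<alpha>)"
| S:     "\<Gamma> \<turnstile>\<^sub>C (\<alpha> \<^bold>\<rightarrow> (\<beta> \<^bold>\<rightarrow> \<gamma>)) \<^bold>\<rightarrow> ((\<alpha> \<^bold>\<rightarrow> \<beta>) \<^bold>\<rightarrow> (\<alpha> \<^bold>\<rightarrow> \<gamma>))"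
| conjI: "\<Gamma> \<turnstile>\<^sub>C \<alpha> \<^bold>\<rightarrow> (\<beta> \<^bold>\<rightarrow> (\<alpha> \<^bold>\<and> \<beta>))"
| conj1: "\<Gamma> \<turnstile>\<^sub>C (\<alpha> \<^bold>\<and> \<beta>) \<^bold>\<rightarrow> \<alpha>"
| conj2: "\<Gamma> \<turnstile>\<^sub>C (\<alpha> \<^bold>\<and> \<beta>) \<^bold>\<rightarrow> \<beta>"
| disj1: "\<Gamma> \<turnstile>\<^sub>C \<alpha> \<^bold>\<rightarrow> (\<alpha> \<^bold>\<or> \<beta>)"
| disj2: "\<Gamma> \<turnstile>\<^sub>C \<beta> \<^bold>\<rightarrow> (\<alpha> \<^bold>\<or> \<beta>)"
| disjE: "\<Gamma> \<turnstile>\<^sub>C (\<alpha> \<^bold>\<rightarrow> \<gamma>) \<^bold>\<rightarrow> ((\<beta> \<^bold>\<rightarrow> \<gamma>) \<^bold>\<rightarrow> ((\<alpha> \<^bold>\<or> \<beta>) \<^bold>\<rightarrow> \<gamma>))"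
| lem:   "\<Gamma> \<turnstile>\<^sub>C \<alpha> \<^bold>\<or> \<^bold>\<not> \<alpha>"
| dne:   "\<Gamma> \<turnstile>\<^sub>C \<^bold>\<not> \<^bold>\<not> \<alpha> \<^bold>\<rightarrow> \<alpha>"
| dummett: "\<Gamma> \<turnstile>\<^sub>C \<alpha> \<^bold>\<or> (\<alpha> \<^bold>\<rightarrow> \<beta>)"

definition set_le :: "('a \<Rightarrow> 'a \<Rightarrow> bool) \<Rightarrow> 'a set \<Rightarrow> 'a set \<Rightarrow> bool" where
  "set_le le A B \<longleftrightarrow> (\<forall>a\<in>A. \<forall>b\<in>B. le a b)"

definition equivalent :: "('a \<Rightarrow> 'a \<Rightarrow> bool) \<Rightarrow> 'a \<Rightarrow> 'a \<Rightarrow> bool" where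
  "equivalent le x y \<longleftrightarrow> le x y \<and> le y x"

definition set_equivalent :: "('a \<Rightarrow> 'a \<Rightarrow> bool) \<Rightarrow> 'a set \<Rightarrow> 'a set \<Rightarrow> bool" where
  "set_equivalent le A B \<longleftrightarrow> (\<forall>a\<in>A. \<forall>b\<in>B. equivalent le a b)"

definition Mins :: "('a \<Rightarrow> 'a \<Rightarrow> bool) \<Rightarrow> 'a set \<Rightarrow> 'a set" where
  "Mins le B = {x \<in> B. set_le le {x} B}"

definition Maxs :: "('a \<Rightarrow> 'a \<Rightarrow> bool) \<Rightarrow> 'a set \<Rightarrow> 'a set" where
  "Maxs le B = {x \<in> B. set_le le B {x}}"

definition Ub :: "'a set \<Rightarrow> ('a \<Rightarrow> 'a \<Rightarrow> bool) \<Rightarrow> 'a set \<Rightarrow> 'a set" where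
  "Ub P le B = {x \<in> P. set_le le B {x}}"

definition Lb :: "'a set \<Rightarrow> ('a \<Rightarrow> 'a \<Rightarrow> bool) \<Rightarrow> 'a set \<Rightarrow> 'a set" where
  "Lb P le B = {x \<in> P. set_le le {x} B}"

definition tops :: "'a set \<Rightarrow> ('a \<Rightarrow> 'a \<Rightarrow> bool) \<Rightarrow> 'a set" where
  "tops P le = Maxs le P"

definition hjoin :: "'a set \<Rightarrow> ('a \<Rightarrow> 'a \<Rightarrow> bool) \<Rightarrow> 'a \<Rightarrow> 'a \<Rightarrow> 'a set" where
  "hjoin P le x y = Mins le (Ub P le {x, y})"

definition hmeet :: "'a set \<Rightarrow> ('a \<Rightarrow> 'a \<Rightarrow> bool) \<Rightarrow> 'a \<Rightarrow> 'a \<Rightarrow> 'a set" where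
  "hmeet P le x y = Maxs le (Lb P le {x, y})"

locale proset =
  fixes P :: "'a set" and le :: "'a \<Rightarrow> 'a \<Rightarrow> bool"
  assumes nonempty: "P \<noteq> {}"
    and refl: "reflp_on P le"
    and trans: "transp_on P le"

text \<open>Structures have an explicit carrier \<open>P\<close>, and the values of relations and hyperoperations
  outside the carrier are irrelevant. The lattice hyperoperations are determined by the preorder
  and are therefore not separate parameters.\<close>

locale hyperlattice = proset +
  assumes hjoin_nonempty: "x \<in> P \<Longrightarrow> y \<in> P \<Longrightarrow> hjoin P le x y \<noteq> {}"
    and hmeet_nonempty: "x \<in> P \<Longrightarrow> y \<in> P \<Longrightarrow> hmeet P le x y \<noteq> {}"

locale IHL = hyperlattice +
  fixes himp :: "'a \<Rightarrow> 'a \<Rightarrow> 'a set"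
  assumes himp_nonempty: "x \<in> P \<Longrightarrow> y \<in> P \<Longrightarrow> himp x y \<noteq> {}"
    and himp_closed: "x \<in> P \<Longrightarrow> y \<in> P \<Longrightarrow> himp x y \<subseteq> P"
    and himp_elim: "x \<in> P \<Longrightarrow> y \<in> P \<Longrightarrow> z \<in> himp x y \<Longrightarrow> set_le le (hmeet P le x z) {y}"
    and himp_intro: "x \<in> P \<Longrightarrow> y \<in> P \<Longrightarrow> z \<in> P \<Longrightarrow> set_le le (hmeet P le x z) {y} \<Longrightarrow>
                       set_le le {z} (himp x y)"
    and himp_equivalent: "x \<in> P \<Longrightarrow> y \<in> P \<Longrightarrow> z \<in> P \<Longrightarrow> z' \<in> P \<Longrightarrow> equivalent le z z' \<Longrightarrow>
                       z \<in> himp x y \<Longrightarrow> z' \<in> himp x y"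

locale CIHL = IHL +
  assumes classical: "x \<in> P \<Longrightarrow> y \<in> P \<Longrightarrow> z \<in> himp x y \<Longrightarrow> w \<in> hjoin P le x z \<Longrightarrow> w \<in> tops P le"

locale HCminA = CIHL +
  fixes hneg :: "'a \<Rightarrow> 'a set"
  assumes hneg_nonempty: "x \<in> P \<Longrightarrow> hneg x \<noteq> {}"
    and hneg_closed: "x \<in> P \<Longrightarrow> hneg x \<subseteq> P"
    and hneg_join: "x \<in> P \<Longrightarrow> y \<in> hneg x \<Longrightarrow> w \<in> hjoin P le x y \<Longrightarrow> w \<in> tops P le"
    and hneg_hneg: "x \<in> P \<Longrightarrow> y \<in> hneg x \<Longrightarrow> w \<in> hneg y \<Longrightarrow> le w x"

record 'a hyperalgebra =
  ha_dom  :: "'a set"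
  ha_conj :: "'a \<Rightarrow> 'a \<Rightarrow> 'a set"
  ha_disj :: "'a \<Rightarrow> 'a \<Rightarrow> 'a set"
  ha_impl :: "'a \<Rightarrow> 'a \<Rightarrow> 'a set"
  ha_neg  :: "'a \<Rightarrow> 'a set"

definition valuation :: "'a hyperalgebra \<Rightarrow> (fm \<Rightarrow> 'a) \<Rightarrow> bool" where
  "valuation A v \<longleftrightarrow>
     (\<forall>\<alpha>. v \<alpha> \<in> ha_dom A) \<and>
     (\<forall>\<alpha> \<beta>. v (\<alpha> \<^bold>\<and> \<beta>) \<in> ha_conj A (v \<alpha>) (v \<beta>)) \<and>
     (\<forall>\<alpha> \<beta>. v (\<alpha> \<^bold>\<or> \<beta>) \<in> ha_disj A (v \<alpha>) (v \<beta>)) \<and>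
     (\<forall>\<alpha> \<beta>. v (\<alpha> \<^bold>\<rightarrow> \<beta>) \<in> ha_impl A (v \<alpha>) (v \<beta>)) \<and>
     (\<forall>\<alpha>. v (\<^bold>\<not> \<alpha>) \<in> ha_neg A (v \<alpha>))"

definition nmatrix_entails :: "'a hyperalgebra \<Rightarrow> 'a set \<Rightarrow> fm set \<Rightarrow> fm \<Rightarrow> bool" where
  "nmatrix_entails A D \<Gamma> \<phi> \<longleftrightarrow>
     (\<forall>v. valuation A v \<longrightarrow> (\<forall>\<gamma>\<in>\<Gamma>. v \<gamma> \<in> D) \<longrightarrow> v \<phi> \<in> D)"

definition HC_hyperalgebra ::
  "'a set \<Rightarrow> ('a \<Rightarrow> 'a \<Rightarrow> bool) \<Rightarrow> ('a \<Rightarrow> 'a \<Rightarrow> 'a set) \<Rightarrow> ('a \<Rightarrow> 'a set) \<Rightarrow> 'a hyperalgebra" where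
  "HC_hyperalgebra H le himp hneg =
     \<lparr>ha_dom = H, ha_conj = hmeet H le, ha_disj = hjoin H le, ha_impl = himp, ha_neg = hneg\<rparr>"

text \<open>HOL cannot quantify over all structures of all types inside a formula, so the two semantic
  consequence relations are relative to a type containing the carriers. Since carriers are
  arbitrary subsets, an infinite type \<open>'a\<close> has structures of every cardinality up to its own,
  finite ones included. A statement with the type variable \<open>'a\<close> of class \<^class>\<open>infinite\<close> left
  free therefore covers all structures.\<close>

definition HCmin_entails :: "'a::infinite itself \<Rightarrow> fm set \<Rightarrow> fm \<Rightarrow> bool" where
  "HCmin_entails TYPE('a) \<Gamma> \<phi> \<longleftrightarrow>
     (\<forall>(H :: 'a set) le himp hneg. HCminA H le himp hneg \<longrightarrow>
        nmatrix_entails (HC_hyperalgebra H le himp hneg) (tops H le) \<Gamma> \<phi>)"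

definition swap_dom :: "'a set \<Rightarrow> ('a \<Rightarrow> 'a \<Rightarrow> bool) \<Rightarrow> ('a \<times> 'a) set" where
  "swap_dom L le =
     {z \<in> L \<times> L. set_equivalent le (hjoin L le (fst z) (snd z)) (tops L le)}"

definition swap_hyperalgebra ::
  "'a set \<Rightarrow> ('a \<Rightarrow> 'a \<Rightarrow> bool) \<Rightarrow> ('a \<Rightarrow> 'a \<Rightarrow> 'a set) \<Rightarrow> ('a \<times> 'a) hyperalgebra" where
  "swap_hyperalgebra L le himp =
     \<lparr>ha_dom = swap_dom L le,
      ha_conj = \<lambda>z w. {u \<in> swap_dom L le. fst u \<in> hmeet L le (fst z) (fst w)},
      ha_disj = \<lambda>z w. {u \<in> swap_dom L le. fst u \<in> hjoin L le (fst z) (fst w)},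
      ha_impl = \<lambda>z w. {u \<in> swap_dom L le. fst u \<in> himp (fst z) (fst w)},
      ha_neg = \<lambda>z. {u \<in> swap_dom L le. fst u = snd z \<and> le (snd u) (fst z)}\<rparr>"

definition swap_designated :: "'a set \<Rightarrow> ('a \<Rightarrow> 'a \<Rightarrow> bool) \<Rightarrow> ('a \<times> 'a) set" where
  "swap_designated L le = {z \<in> swap_dom L le. fst z \<in> tops L le}"

definition HSW_entails :: "'a::infinite itself \<Rightarrow> fm set \<Rightarrow> fm \<Rightarrow> bool" where
  "HSW_entails TYPE('a) \<Gamma> \<phi> \<longleftrightarrow>
     (\<forall>(L :: 'a set) le himp. CIHL L le himp \<longrightarrow>
        nmatrix_entails (swap_hyperalgebra L le himp) (swap_designated L le) \<Gamma> \<phi>)"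

end

theory Submission
  imports Defs
begin

text \<open>Soundness: in a CIHL, read \<open>c \<preceq> f \<alpha>\<close> as ``\<open>c\<close> forces \<open>\<alpha>\<close>''. Implication then has its Kripke
  clause, and soundness needs only that \<open>f\<close> commutes with the three binary connectives, that
  \<open>f \<alpha> \<curlyvee> f (\<not>\<alpha>)\<close> consists of tops and that \<open>f (\<not>\<not>\<alpha>) \<preceq> f \<alpha>\<close>. A valuation \<open>v\<close> over an HCminA and the
  first projection \<open>fst \<circ> v\<close> of a valuation over a swap structure are both of this kind.

  Completeness: a maximal set not deriving \<open>\<phi>\<close> yields a two-valued interpretation, classical on the
  positive fragment. It factors through the two-element CIHL \<open>{0, 1}\<close> by
  \<open>\<alpha> \<mapsto> (b \<alpha>, b (\<not>\<alpha>))\<close>; the three pairs that can occur, \<open>(0, 1)\<close>, \<open>(1, 1)\<close> and \<open>(1, 0)\<close>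
  (\<open>F\<close>, \<open>B\<close> and \<open>T\<close> below), also form an HCminA, preordered by the first component.\<close>

section \<open>Soundness\<close>

context IHL
begin

lemma le_refl: "x \<in> P \<Longrightarrow> le x x"
  using refl by (auto simp: reflp_on_def)

lemma le_trans: "x \<in> P \<Longrightarrow> y \<in> P \<Longrightarrow> z \<in> P \<Longrightarrow> le x y \<Longrightarrow> le y z \<Longrightarrow> le x z"
  using trans by (meson transp_onD)

lemma tops_iff: "t \<in> tops P le \<longleftrightarrow> t \<in> P \<and> (\<forall>x\<in>P. le x t)"
  by (auto simp: tops_def Maxs_def set_le_def)

lemma hjoin_iff:
  "x \<in> P \<Longrightarrow> y \<in> P \<Longrightarrow>
    z \<in> hjoin P le x y \<longleftrightarrow> z \<in> P \<and> le x z \<and> le y z \<and> (\<forall>u\<in>P. le x u \<longrightarrow> le y u \<longrightarrow> le z u)"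
  by (auto simp: hjoin_def Mins_def Ub_def set_le_def)

lemma hmeet_iff:
  "x \<in> P \<Longrightarrow> y \<in> P \<Longrightarrow>
    z \<in> hmeet P le x y \<longleftrightarrow> z \<in> P \<and> le z x \<and> le z y \<and> (\<forall>u\<in>P. le u x \<longrightarrow> le u y \<longrightarrow> le u z)"
  by (auto simp: hmeet_def Maxs_def Lb_def set_le_def)

lemma le_hmeet_iff:
  assumes "x \<in> P" "y \<in> P" "z \<in> hmeet P le x y" "c \<in> P"
  shows "le c z \<longleftrightarrow> le c x \<and> le c y"
proof -
  have "z \<in> P" "le z x" "le z y" "\<forall>u\<in>P. le u x \<longrightarrow> le u y \<longrightarrow> le u z"
    using assms(3) unfolding hmeet_iff[OF assms(1,2)] by simp_all
  then show ?thesis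
    using le_trans[of c z x] le_trans[of c z y] assms(1,2,4) by blast
qed

text \<open>Any member of the meet is a greatest lower bound, so bounding it bounds all lower
  bounds. Nonemptiness of the meet keeps the left side from being vacuous.\<close>

lemma hmeet_le_iff:
  assumes "x \<in> P" "y \<in> P" "z \<in> P"
  shows "set_le le (hmeet P le x y) {z} \<longleftrightarrow> (\<forall>c\<in>P. le c x \<longrightarrow> le c y \<longrightarrow> le c z)"
proof
  assume L: "set_le le (hmeet P le x y) {z}"
  obtain m where m: "m \<in> hmeet P le x y"
    using hmeet_nonempty assms by blast
  then have "le m z"
    using L by (simp add: set_le_def)
  moreover have "m \<in> P"
    using m assms by (simp add: hmeet_iff)
  ultimately show "\<forall>c\<in>P. le c x \<longrightarrow> le c y \<longrightarrow> le c z"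
    using le_hmeet_iff[OF assms(1,2) m] le_trans[OF _ _ assms(3)] by blast
next
  assume "\<forall>c\<in>P. le c x \<longrightarrow> le c y \<longrightarrow> le c z"
  then show "set_le le (hmeet P le x y) {z}"
    using assms by (auto simp: set_le_def hmeet_iff)
qed

text \<open>Residuation in pointwise form: \<open>himp_elim\<close> gives one direction,
  \<open>himp_intro\<close> at \<open>c\<close> the other. It applies to every member of
  \<open>himp x y\<close>, so later arguments do not depend on which value is chosen.\<close>

lemma le_himp_iff:
  assumes "x \<in> P" "y \<in> P" "z \<in> himp x y" "c \<in> P"
  shows "le c z \<longleftrightarrow> (\<forall>d\<in>P. le d c \<longrightarrow> le d x \<longrightarrow> le d y)"
proof
  have z: "z \<in> P"
    using assms himp_closed by blast
  assume "le c z"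
  moreover have "\<forall>d\<in>P. le d x \<longrightarrow> le d z \<longrightarrow> le d y"
    using himp_elim[OF assms(1-3)] hmeet_le_iff[OF assms(1) z assms(2)] by blast
  ultimately show "\<forall>d\<in>P. le d c \<longrightarrow> le d x \<longrightarrow> le d y"
    using le_trans[OF _ assms(4) z] by blast
next
  assume "\<forall>d\<in>P. le d c \<longrightarrow> le d x \<longrightarrow> le d y"
  then have "set_le le (hmeet P le x c) {y}"
    using assms by (simp add: hmeet_le_iff)
  then show "le c z"
    using himp_intro[of x y c] assms by (auto simp: set_le_def)
qed

text \<open>Distributivity comes from residuation: \<open>x\<close> and \<open>y\<close> lie below \<open>c \<multimap> w\<close>, hence so does their join.\<close>

lemma le_hjoin_elim:
  assumes "x \<in> P" "y \<in> P" "w \<in> P" "c \<in> P" "z \<in> hjoin P le x y"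
    and x: "\<And>d. d \<in> P \<Longrightarrow> le d c \<Longrightarrow> le d x \<Longrightarrow> le d w"
    and y: "\<And>d. d \<in> P \<Longrightarrow> le d c \<Longrightarrow> le d y \<Longrightarrow> le d w"
    and "le c z"
  shows "le c w"
proof -
  obtain i where i: "i \<in> himp c w"
    using himp_nonempty \<open>c \<in> P\<close> \<open>w \<in> P\<close> by blast
  then have iP: "i \<in> P"
    using himp_closed \<open>c \<in> P\<close> \<open>w \<in> P\<close> by blast
  have "le x i" "le y i"
    using le_himp_iff[OF \<open>c \<in> P\<close> \<open>w \<in> P\<close> i] \<open>x \<in> P\<close> \<open>y \<in> P\<close> x y by simp_all
  then have "le z i" "z \<in> P"
    using \<open>z \<in> hjoin P le x y\<close> \<open>x \<in> P\<close> \<open>y \<in> P\<close> iP by (simp_all add: hjoin_iff)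
  then have "le c i"
    using le_trans[OF \<open>c \<in> P\<close> _ iP \<open>le c z\<close>] by blast
  then show ?thesis
    using le_himp_iff[OF \<open>c \<in> P\<close> \<open>w \<in> P\<close> i \<open>c \<in> P\<close>] \<open>c \<in> P\<close> le_refl by blast
qed

text \<open>The Kripke clause of \<open>himp x x\<close> is trivially true, so its members are tops.
  Without a top, the equivalence with \<open>tops\<close> that defines \<open>swap_dom\<close> would
  hold vacuously.\<close>

lemma tops_nonempty: "tops P le \<noteq> {}"
proof -
  obtain x where x: "x \<in> P"
    using nonempty by blast
  then obtain t where "t \<in> himp x x"
    using himp_nonempty by blast
  then have "t \<in> tops P le"
    using x himp_closed le_himp_iff[of x x t] by (auto simp: tops_iff)
  then show ?thesis by blast
qed

end

section \<open>Soundness of the calculus\<close>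

context CIHL
begin

lemma soundness:
  assumes dom: "\<And>\<alpha>. f \<alpha> \<in> P"
    and conj: "\<And>\<alpha> \<beta>. f (\<alpha> \<^bold>\<and> \<beta>) \<in> hmeet P le (f \<alpha>) (f \<beta>)"
    and disj: "\<And>\<alpha> \<beta>. f (\<alpha> \<^bold>\<or> \<beta>) \<in> hjoin P le (f \<alpha>) (f \<beta>)"
    and impl: "\<And>\<alpha> \<beta>. f (\<alpha> \<^bold>\<rightarrow> \<beta>) \<in> himp (f \<alpha>) (f \<beta>)"
    and lem: "\<And>\<alpha>. hjoin P le (f \<alpha>) (f (\<^bold>\<not> \<alpha>)) \<subseteq> tops P le"
    and dne: "\<And>\<alpha>. le (f (\<^bold>\<not> \<^bold>\<not> \<alpha>)) (f \<alpha>)"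
    and "\<Gamma> \<turnstile>\<^sub>C \<phi>" and hyps: "\<And>\<gamma>. \<gamma> \<in> \<Gamma> \<Longrightarrow> f \<gamma> \<in> tops P le"
  shows "f \<phi> \<in> tops P le"
  using \<open>\<Gamma> \<turnstile>\<^sub>C \<phi>\<close>
proof induction
  \<comment> \<open>Persistence: what a point forces is forced by every point below it.\<close>
  note mono = le_trans[OF _ _ dom]
  \<comment> \<open>The implicational axioms are checked through this reduction to forcing; the two
    disjunctive ones, \<open>lem\<close> and \<open>dummett\<close>, are tops by the conditions on
    joins.\<close>
  have impI: "f (\<alpha> \<^bold>\<rightarrow> \<beta>) \<in> tops P le" if "\<And>c. c \<in> P \<Longrightarrow> le c (f \<alpha>) \<Longrightarrow> le c (f \<beta>)" for \<alpha> \<beta>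
    using le_himp_iff[OF dom dom impl] dom that by (auto simp: tops_iff)
  have le_imp: "le c (f (\<alpha> \<^bold>\<rightarrow> \<beta>)) \<longleftrightarrow> (\<forall>d\<in>P. le d c \<longrightarrow> le d (f \<alpha>) \<longrightarrow> le d (f \<beta>))"
    if "c \<in> P" for c \<alpha> \<beta>
    using le_himp_iff[OF dom dom impl that] .
  have le_conj: "le c (f (\<alpha> \<^bold>\<and> \<beta>)) \<longleftrightarrow> le c (f \<alpha>) \<and> le c (f \<beta>)" if "c \<in> P" for c \<alpha> \<beta>
    using le_hmeet_iff[OF dom dom conj that] .
  have le_disj: "le c (f \<alpha>) \<Longrightarrow> le c (f (\<alpha> \<^bold>\<or> \<beta>))" "le c (f \<beta>) \<Longrightarrow> le c (f (\<alpha> \<^bold>\<or> \<beta>))"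
    if "c \<in> P" for c \<alpha> \<beta>
    using disj[of \<alpha> \<beta>] dom that le_trans[of c "f \<alpha>" "f (\<alpha> \<^bold>\<or> \<beta>)"] le_trans[of c "f \<beta>" "f (\<alpha> \<^bold>\<or> \<beta>)"]
    by (auto simp: hjoin_iff)
  {
    case (hyp \<gamma>)
    then show ?case by (rule hyps)
  next
    case (mp \<alpha> \<beta>)
    then show ?case
      using dom le_refl by (auto simp: tops_iff le_imp)
  next
    case (K \<alpha> \<beta>)
    show ?case
      by (rule impI) (simp add: le_imp, blast intro: mono)
  next
    case (S \<alpha> \<beta> \<gamma>)
    show ?case
    proof (rule impI)
      fix a
      assume a: "a \<in> P" "le a (f (\<alpha> \<^bold>\<rightarrow> (\<beta> \<^bold>\<rightarrow> \<gamma>)))"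
      \<comment> \<open>Both implications persist down to \<open>c\<close>, the point where \<alpha>
        is forced, and are applied there.\<close>
      have "le c (f \<gamma>)"
        if "b \<in> P" "le b a" "le b (f (\<alpha> \<^bold>\<rightarrow> \<beta>))" "c \<in> P" "le c b" "le c (f \<alpha>)" for b c
      proof -
        have "le c a"
          using that a le_trans[of c b a] by blast
        then have "le c (f (\<beta> \<^bold>\<rightarrow> \<gamma>))" "le c (f \<beta>)"
          using that a by (auto simp: le_imp)
        then show ?thesis
          using that le_refl by (auto simp: le_imp)
      qed
      then show "le a (f ((\<alpha> \<^bold>\<rightarrow> \<beta>) \<^bold>\<rightarrow> (\<alpha> \<^bold>\<rightarrow> \<gamma>)))"
        using a by (auto simp: le_imp)
    qed
  next
    case (conjI \<alpha> \<beta>)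
    show ?case
      by (rule impI) (simp add: le_imp le_conj, blast intro: mono)
  next
    case (conj1 \<alpha> \<beta>)
    show ?case
      by (rule impI) (simp add: le_conj)
  next
    case (conj2 \<alpha> \<beta>)
    show ?case
      by (rule impI) (simp add: le_conj)
  next
    case (disj1 \<alpha> \<beta>)
    show ?case
      by (rule impI) (rule le_disj)
  next
    case (disj2 \<beta> \<alpha>)
    show ?case
      by (rule impI) (rule le_disj)
  next
    case (disjE \<alpha> \<gamma> \<beta>)
    show ?case
    proof (rule impI)
      fix a
      assume "a \<in> P" "le a (f (\<alpha> \<^bold>\<rightarrow> \<gamma>))"
      show "le a (f ((\<beta> \<^bold>\<rightarrow> \<gamma>) \<^bold>\<rightarrow> ((\<alpha> \<^bold>\<or> \<beta>) \<^bold>\<rightarrow> \<gamma>)))"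
      proof -
        \<comment> \<open>A point may force a disjunction without forcing either disjunct. The case
          split is therefore left to \<open>le_hjoin_elim\<close>, which requires the two cases at
          all points below \<open>c\<close>.\<close>
        have "le c (f \<gamma>)"
          if "c \<in> P" "b \<in> P" "le b a" "le b (f (\<beta> \<^bold>\<rightarrow> \<gamma>))" "le c b" "le c (f (\<alpha> \<^bold>\<or> \<beta>))" for b c
        proof (rule le_hjoin_elim[OF dom dom dom that(1) disj _ _ that(6)])
          fix d
          assume "d \<in> P" "le d c"
          then have "le d b" "le d a"
            using that \<open>a \<in> P\<close> le_trans[of d c b] le_trans[of d b a] by blast+
          then show "le d (f \<alpha>) \<Longrightarrow> le d (f \<gamma>)" "le d (f \<beta>) \<Longrightarrow> le d (f \<gamma>)"
            using that \<open>a \<in> P\<close> \<open>d \<in> P\<close> \<open>le a (f (\<alpha> \<^bold>\<rightarrow> \<gamma>))\<close> by (auto simp: le_imp)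
        qed
        then show ?thesis
          using \<open>a \<in> P\<close> by (auto simp: le_imp)
      qed
    qed
  next
    case (lem \<alpha>)
    show ?case
      using assms(5) disj by blast
  next
    case (dne \<alpha>)
    show ?case
      by (rule impI) (blast intro: mono[OF _ dom] assms(6))
  next
    case (dummett \<alpha> \<beta>)
    show ?case
      using classical[OF dom dom impl disj] .
  }
qed

end

lemma HCmin_sound:
  assumes "\<Gamma> \<turnstile>\<^sub>C \<phi>"
  shows "HCmin_entails TYPE('a::infinite) \<Gamma> \<phi>"
  unfolding HCmin_entails_def nmatrix_entails_def
proof (intro allI impI)
  fix H :: "'a set" and le himp hneg v
  assume "HCminA H le himp hneg"
  then interpret HCminA H le himp hneg .
  assume v: "valuation (HC_hyperalgebra H le himp hneg) v" and \<Gamma>: "\<forall>\<gamma>\<in>\<Gamma>. v \<gamma> \<in> tops H le"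
  then have dom: "v \<alpha> \<in> H" and neg: "v (\<^bold>\<not> \<alpha>) \<in> hneg (v \<alpha>)" for \<alpha>
    by (auto simp: valuation_def HC_hyperalgebra_def)
  show "v \<phi> \<in> tops H le"
    by (rule soundness[OF _ _ _ _ _ _ assms])
      (use v \<Gamma> hneg_join[OF dom neg] hneg_hneg[OF dom neg neg] in
        \<open>auto simp: valuation_def HC_hyperalgebra_def\<close>)
qed

lemma HSW_sound:
  assumes "\<Gamma> \<turnstile>\<^sub>C \<phi>"
  shows "HSW_entails TYPE('a::infinite) \<Gamma> \<phi>"
  unfolding HSW_entails_def nmatrix_entails_def
proof (intro allI impI)
  fix L :: "'a set" and le himp v
  assume "CIHL L le himp"
  then interpret CIHL L le himp .
  assume v: "valuation (swap_hyperalgebra L le himp) v"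
    and \<Gamma>: "\<forall>\<gamma>\<in>\<Gamma>. v \<gamma> \<in> swap_designated L le"
  have dom: "v \<alpha> \<in> swap_dom L le" for \<alpha>
    using v by (auto simp: valuation_def swap_hyperalgebra_def)
  \<comment> \<open>The first equation turns the condition defining the domain into excluded middle;
    applied to the negation of \<alpha>, it turns the inequality into double negation
    elimination.\<close>
  have neg: "fst (v (\<^bold>\<not> \<alpha>)) = snd (v \<alpha>)" "le (snd (v (\<^bold>\<not> \<alpha>))) (fst (v \<alpha>))" for \<alpha>
    using v by (auto simp: valuation_def swap_hyperalgebra_def)
  have fst_snd: "fst (v \<alpha>) \<in> L" "snd (v \<alpha>) \<in> L" for \<alpha>
    using dom[of \<alpha>] by (auto simp: swap_dom_def)
  have join: "hjoin L le (fst (v \<alpha>)) (snd (v \<alpha>)) \<subseteq> tops L le" for \<alpha>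
  proof
    fix w
    assume w: "w \<in> hjoin L le (fst (v \<alpha>)) (snd (v \<alpha>))"
    then have "w \<in> L"
      using fst_snd by (simp add: hjoin_iff)
    obtain t where t: "t \<in> tops L le"
      using tops_nonempty by blast
    then have "le t w"
      using w dom[of \<alpha>] by (auto simp: swap_dom_def set_equivalent_def equivalent_def)
    then show "w \<in> tops L le"
      using t \<open>w \<in> L\<close> by (auto simp: tops_iff intro: le_trans[of _ t w])
  qed
  have "fst (v \<phi>) \<in> tops L le"
    by (rule soundness[OF _ _ _ _ _ _ assms, of "\<lambda>\<alpha>. fst (v \<alpha>)"])
      (use v \<Gamma> fst_snd neg join in
        \<open>auto simp: valuation_def swap_hyperalgebra_def swap_designated_def\<close>)
  then show "v \<phi> \<in> swap_designated L le"
    using dom by (simp add: swap_designated_def)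
qed

section \<open>Completeness\<close>

lemma derives_mono: "\<Gamma> \<turnstile>\<^sub>C \<phi> \<Longrightarrow> \<Gamma> \<subseteq> \<Delta> \<Longrightarrow> \<Delta> \<turnstile>\<^sub>C \<phi>"
  proof (induction rule: Cmin_derives.induct)
  case (hyp \<gamma>)
  then show ?case by (auto intro: Cmin_derives.hyp)
next
  case (mp \<alpha> \<beta>)
  then show ?case by (auto intro: Cmin_derives.mp)
\<comment> \<open>From the third rule on come the axiom schemas, derivable from any set.\<close>
qed (rule Cmin_derives.intros(3-))+

lemma derives_imp_weaken: "\<Gamma> \<turnstile>\<^sub>C \<beta> \<Longrightarrow> \<Gamma> \<turnstile>\<^sub>C \<alpha> \<^bold>\<rightarrow> \<beta>"
  by (rule Cmin_derives.mp[OF _ Cmin_derives.K])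

text \<open>The combinator identity I = S K K.\<close>

lemma derives_imp_refl: "\<Gamma> \<turnstile>\<^sub>C \<alpha> \<^bold>\<rightarrow> \<alpha>"
  by (rule Cmin_derives.mp[OF Cmin_derives.K Cmin_derives.mp[OF Cmin_derives.K Cmin_derives.S]])

lemma deduction: "insert \<alpha> \<Gamma> \<turnstile>\<^sub>C \<beta> \<Longrightarrow> \<Gamma> \<turnstile>\<^sub>C \<alpha> \<^bold>\<rightarrow> \<beta>"
proof (induction rule: Cmin_derives.induct)
  case (hyp \<gamma>)
  then show ?case
    by (auto intro: derives_imp_refl derives_imp_weaken Cmin_derives.hyp)
next
  case (mp \<beta> \<gamma>)
  then show ?case
    by (meson Cmin_derives.mp Cmin_derives.S)
qed (rule derives_imp_weaken, rule Cmin_derives.intros(3-))+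

text \<open>A derivation uses finitely many hypotheses, and these lie in one member of the chain. In
  the induction this appears at modus ponens, where the larger of two members derives both
  premises.\<close>

lemma derives_Union_chain:
  assumes "subset.chain A C" "C \<noteq> {}" "\<Union>C \<turnstile>\<^sub>C \<phi>"
  shows "\<exists>\<Delta>\<in>C. \<Delta> \<turnstile>\<^sub>C \<phi>"
proof -
  \<comment> \<open>A default member of the chain, from which the axioms are derived.\<close>
  obtain \<Delta>\<^sub>0 where "\<Delta>\<^sub>0 \<in> C"
    using assms(2) by blast
  from assms(3) show ?thesis
  proof (induction rule: Cmin_derives.induct)
    case (hyp \<gamma>)
    then show ?case by (blast intro: Cmin_derives.hyp)
  next
    case (mp \<alpha> \<beta>)
    then obtain \<Delta> \<Delta>' where "\<Delta> \<in> C" "\<Delta> \<turnstile>\<^sub>C \<alpha>" "\<Delta>' \<in> C" "\<Delta>' \<turnstile>\<^sub>C \<alpha> \<^bold>\<rightarrow> \<beta>"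
      by blast
    moreover from this have "\<Delta> \<subseteq> \<Delta>' \<or> \<Delta>' \<subseteq> \<Delta>"
      using assms(1) by (auto simp: subset_chain_def)
    ultimately show ?case
      by (meson Cmin_derives.mp derives_mono)
  qed (rule bexI[OF _ \<open>\<Delta>\<^sub>0 \<in> C\<close>], rule Cmin_derives.intros(3-))+
qed

section \<open>Two-valued interpretations from maximal sets\<close>

definition bivaluation :: "fm set \<Rightarrow> bool" where
  "bivaluation \<Delta> \<longleftrightarrow>
    (\<forall>\<alpha> \<beta>. (\<alpha> \<^bold>\<and> \<beta>) \<in> \<Delta> \<longleftrightarrow> \<alpha> \<in> \<Delta> \<and> \<beta> \<in> \<Delta>) \<and>
    (\<forall>\<alpha> \<beta>. (\<alpha> \<^bold>\<or> \<beta>) \<in> \<Delta> \<longleftrightarrow> \<alpha> \<in> \<Delta> \<or> \<beta> \<in> \<Delta>) \<and>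
    (\<forall>\<alpha> \<beta>. (\<alpha> \<^bold>\<rightarrow> \<beta>) \<in> \<Delta> \<longleftrightarrow> (\<alpha> \<in> \<Delta> \<longrightarrow> \<beta> \<in> \<Delta>)) \<and>
    (\<forall>\<alpha>. \<alpha> \<in> \<Delta> \<or> (\<^bold>\<not> \<alpha>) \<in> \<Delta>) \<and>
    (\<forall>\<alpha>. (\<^bold>\<not> \<^bold>\<not> \<alpha>) \<in> \<Delta> \<longrightarrow> \<alpha> \<in> \<Delta>)"

text \<open>Lindenbaum construction by Zorn's lemma. The negation clauses of
  \<open>bivaluation\<close> are not truth-functional: when a formula and its negation both lie in
  the set, the double negation remains free.\<close>

lemma bivaluation_exists:
  assumes "\<not> \<Gamma> \<turnstile>\<^sub>C \<phi>"
  obtains \<Delta> where "bivaluation \<Delta>" "\<Gamma> \<subseteq> \<Delta>" "\<phi> \<notin> \<Delta>"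
proof -
  let ?A = "{\<Delta>. \<Gamma> \<subseteq> \<Delta> \<and> \<not> \<Delta> \<turnstile>\<^sub>C \<phi>}"
  have "\<exists>M\<in>?A. \<forall>X\<in>?A. M \<subseteq> X \<longrightarrow> X = M"
  proof (rule subset_Zorn_nonempty)
    show "?A \<noteq> {}"
      using assms by blast
    show "\<Union>C \<in> ?A" if "C \<noteq> {}" "subset.chain ?A C" for C
    proof -
      have "C \<subseteq> ?A"
        using that by (auto simp: subset_chain_def)
      moreover from this have "\<not> \<Union>C \<turnstile>\<^sub>C \<phi>"
        using derives_Union_chain[OF that(2,1)] by blast
      ultimately show ?thesis
        using that(1) by blast
    qed
  qed
  then obtain \<Delta> where mem: "\<Delta> \<in> ?A" and all: "\<forall>X\<in>?A. \<Delta> \<subseteq> X \<longrightarrow> X = \<Delta>"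
    by (rule bexE)
  from mem have \<Delta>: "\<Gamma> \<subseteq> \<Delta>" "\<not> \<Delta> \<turnstile>\<^sub>C \<phi>"
    by simp_all
  have max: "X = \<Delta>" if "\<Delta> \<subseteq> X" "\<not> X \<turnstile>\<^sub>C \<phi>" for X
    using all that \<Delta>(1) by auto
  \<comment> \<open>Adding \<alpha> to the maximal set makes \<phi> derivable; the deduction theorem
    does the rest. Closure and primeness both follow from this.\<close>
  have notin: "\<Delta> \<turnstile>\<^sub>C \<alpha> \<^bold>\<rightarrow> \<phi>" if "\<alpha> \<notin> \<Delta>" for \<alpha>
    using max[of "insert \<alpha> \<Delta>"] that deduction[of \<alpha> \<Delta> \<phi>] by blast
  note mp = Cmin_derives.mp
  have closed: "\<alpha> \<in> \<Delta> \<longleftrightarrow> \<Delta> \<turnstile>\<^sub>C \<alpha>" for \<alpha>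
    using mp[of \<Delta> \<alpha> \<phi>] notin[of \<alpha>] \<Delta>(2) Cmin_derives.hyp[of \<alpha> \<Delta>] by blast
  have conj: "(\<alpha> \<^bold>\<and> \<beta>) \<in> \<Delta> \<longleftrightarrow> \<alpha> \<in> \<Delta> \<and> \<beta> \<in> \<Delta>" for \<alpha> \<beta>
    unfolding closed
    using mp[OF _ Cmin_derives.conj1[of \<Delta> \<alpha> \<beta>]] mp[OF _ Cmin_derives.conj2[of \<Delta> \<alpha> \<beta>]]
      mp[OF _ mp[OF _ Cmin_derives.conjI[of \<Delta> \<alpha> \<beta>]]] by blast
  have prime: "\<alpha> \<in> \<Delta> \<or> \<beta> \<in> \<Delta>" if "\<Delta> \<turnstile>\<^sub>C \<alpha> \<^bold>\<or> \<beta>" for \<alpha> \<beta>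
    using notin[of \<alpha>] notin[of \<beta>] \<Delta>(2)
      mp[OF that mp[OF _ mp[OF _ Cmin_derives.disjE[of \<Delta> \<alpha> \<phi> \<beta>]]]] by blast
  have disj: "(\<alpha> \<^bold>\<or> \<beta>) \<in> \<Delta> \<longleftrightarrow> \<alpha> \<in> \<Delta> \<or> \<beta> \<in> \<Delta>" for \<alpha> \<beta>
    using prime[of \<alpha> \<beta>] mp[OF _ Cmin_derives.disj1[of \<Delta> \<alpha> \<beta>]]
      mp[OF _ Cmin_derives.disj2[of \<Delta> \<beta> \<alpha>]] unfolding closed by blast
  \<comment> \<open>If \<alpha> is missing, primeness applied to \<open>dummett\<close> puts the
    implication into \<Delta>: this makes implication classical.\<close>
  have impl: "(\<alpha> \<^bold>\<rightarrow> \<beta>) \<in> \<Delta> \<longleftrightarrow> (\<alpha> \<in> \<Delta> \<longrightarrow> \<beta> \<in> \<Delta>)" for \<alpha> \<beta>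
    using prime[OF Cmin_derives.dummett[of \<Delta> \<alpha> \<beta>]] mp[of \<Delta> \<alpha> \<beta>]
      derives_imp_weaken[of \<Delta> \<beta> \<alpha>] unfolding closed by blast
  have lem: "\<alpha> \<in> \<Delta> \<or> (\<^bold>\<not> \<alpha>) \<in> \<Delta>" for \<alpha>
    by (rule prime[OF Cmin_derives.lem])
  have dne: "\<alpha> \<in> \<Delta>" if "(\<^bold>\<not> \<^bold>\<not> \<alpha>) \<in> \<Delta>" for \<alpha>
    using that mp[OF _ Cmin_derives.dne[of \<Delta> \<alpha>]] unfolding closed by blast
  have "bivaluation \<Delta>"
    unfolding bivaluation_def using conj disj impl lem dne by simp
  moreover have "\<phi> \<notin> \<Delta>"
    using closed \<Delta>(2) by blast
  ultimately show ?thesis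
    using that \<Delta>(1) by blast
qed

section \<open>Countermodels with two equivalence classes\<close>

lemma infinite_type_inj: "\<exists>e :: nat \<Rightarrow> 'a::infinite. inj e"
  using infinite_UNIV infinite_countable_subset by blast

text \<open>Common core of both countermodels. Up to equivalence \<open>P\<close> is the two-element
  Boolean algebra, and each binary hyperoperation returns the whole class of the Boolean value. A
  class may have several members, which leaves room for a negation that distinguishes equivalent
  elements.\<close>

locale two_classes =
  fixes P :: "'a set" and T :: "'a \<Rightarrow> bool"
  assumes ex_true: "\<exists>x\<in>P. T x" and ex_false: "\<exists>x\<in>P. \<not> T x"
begin

abbreviation le :: "'a \<Rightarrow> 'a \<Rightarrow> bool" where
  "le x y \<equiv> T x \<longrightarrow> T y"

abbreviation himp :: "'a \<Rightarrow> 'a \<Rightarrow> 'a set" where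
  "himp x y \<equiv> {z \<in> P. T z \<longleftrightarrow> (T x \<longrightarrow> T y)}"

lemma tops_eq: "tops P le = {z \<in> P. T z}"
  using ex_true by (auto simp: tops_def Maxs_def set_le_def)

lemma hjoin_eq: "x \<in> P \<Longrightarrow> y \<in> P \<Longrightarrow> hjoin P le x y = {z \<in> P. T z \<longleftrightarrow> T x \<or> T y}"
  using ex_false by (auto simp: hjoin_def Mins_def Ub_def set_le_def)

lemma hmeet_eq: "x \<in> P \<Longrightarrow> y \<in> P \<Longrightarrow> hmeet P le x y = {z \<in> P. T z \<longleftrightarrow> T x \<and> T y}"
  using ex_true by (auto simp: hmeet_def Maxs_def Lb_def set_le_def)

lemma swap_dom_eq: "swap_dom P le = {z \<in> P \<times> P. T (fst z) \<or> T (snd z)}"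
proof -
  have "set_equivalent le (hjoin P le x y) (tops P le) \<longleftrightarrow> T x \<or> T y" if "x \<in> P" "y \<in> P" for x y
    using ex_true that by (auto simp: set_equivalent_def equivalent_def hjoin_eq tops_eq)
  then show ?thesis
    unfolding swap_dom_def by auto
qed

lemma CIHL: "CIHL P le himp"
proof
  show "P \<noteq> {}"
    using ex_true by blast
  show "reflp_on P le" "transp_on P le"
    by (auto simp: reflp_on_def transp_on_def)
qed (use ex_true ex_false in \<open>auto simp: hjoin_eq hmeet_eq tops_eq set_le_def equivalent_def\<close>)

end

lemma HCmin_complete:
  assumes "HCmin_entails TYPE('a::infinite) \<Gamma> \<phi>"
  shows "\<Gamma> \<turnstile>\<^sub>C \<phi>"
proof (rule ccontr)
  assume "\<not> \<Gamma> \<turnstile>\<^sub>C \<phi>"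
  then obtain \<Delta> where \<Delta>: "bivaluation \<Delta>" "\<Gamma> \<subseteq> \<Delta>" "\<phi> \<notin> \<Delta>"
    by (rule bivaluation_exists)
  obtain e :: "nat \<Rightarrow> 'a" where "inj e"
    using infinite_type_inj by blast
  define F B T where "F = e 0" and "B = e 1" and "T = e 2"
  then have distinct: "F \<noteq> B" "F \<noteq> T" "B \<noteq> T"
    by (simp_all add: inj_eq[OF \<open>inj e\<close>])
  define P where "P = {F, B, T}"
  interpret two_classes P "\<lambda>x. x \<noteq> F"
    by standard (use distinct in \<open>auto simp: P_def\<close>)
  interpret CIHL P le himp
    by (rule CIHL)
  \<comment> \<open>The negation of the swap structure over \<open>{0, 1}\<close>, transported to
    \<open>F\<close>, \<open>B\<close>, \<open>T\<close>: the second component becomes the first,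
    and the new second component is at most the old first one. Only \<open>B\<close> leaves a
    choice.\<close>
  define hneg where "hneg x = (if x = F then {T} else if x = B then {B, T} else {F})" for x
  have P_iff: "x \<in> P \<longleftrightarrow> x = F \<or> x = B \<or> x = T" for x
    by (simp add: P_def)
  \<comment> \<open>The two negation laws have content only at \<open>F\<close>: its negation
    \<open>T\<close> is a top, and the negation of \<open>T\<close> is \<open>F\<close>
    again.\<close>
  have HC: "HCminA P le himp hneg"
    by unfold_locales (use distinct in \<open>auto simp: hneg_def hjoin_eq tops_eq P_iff split: if_splits\<close>)
  define v where "v \<alpha> = (if \<alpha> \<notin> \<Delta> then F else if (\<^bold>\<not> \<alpha>) \<in> \<Delta> then B else T)" for \<alpha>
  have v_in: "v \<alpha> \<in> P" and v_F: "v \<alpha> = F \<longleftrightarrow> \<alpha> \<notin> \<Delta>" for \<alpha>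
    using distinct by (auto simp: v_def P_def)
  \<comment> \<open>The delicate case is \<alpha> outside \<Delta>: excluded middle puts its
    negation into \<Delta> and the other clause keeps its double negation out, so the value is
    \<open>T\<close>, as \<open>hneg F\<close> demands.\<close>
  have "v (\<^bold>\<not> \<alpha>) \<in> hneg (v \<alpha>)" for \<alpha>
    using \<Delta>(1) distinct by (auto simp: bivaluation_def v_def hneg_def)
  then have "valuation (HC_hyperalgebra P le himp hneg) v"
    using \<Delta>(1) v_in
    by (auto simp: valuation_def HC_hyperalgebra_def hjoin_eq hmeet_eq v_F bivaluation_def)
  moreover have "v \<alpha> \<in> tops P le \<longleftrightarrow> \<alpha> \<in> \<Delta>" for \<alpha>
    using v_in v_F by (auto simp: tops_eq)
  ultimately show False
    using assms HC \<Delta>(2,3) unfolding HCmin_entails_def nmatrix_entails_def by blast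
qed

lemma HSW_complete:
  assumes "HSW_entails TYPE('a::infinite) \<Gamma> \<phi>"
  shows "\<Gamma> \<turnstile>\<^sub>C \<phi>"
proof (rule ccontr)
  assume "\<not> \<Gamma> \<turnstile>\<^sub>C \<phi>"
  then obtain \<Delta> where \<Delta>: "bivaluation \<Delta>" "\<Gamma> \<subseteq> \<Delta>" "\<phi> \<notin> \<Delta>"
    by (rule bivaluation_exists)
  obtain e :: "nat \<Rightarrow> 'a" where "inj e"
    using infinite_type_inj by blast
  define F T where "F = e 0" and "T = e 1"
  then have distinct: "F \<noteq> T"
    by (simp_all add: inj_eq[OF \<open>inj e\<close>])
  define P where "P = {F, T}"
  interpret two_classes P "\<lambda>x. x \<noteq> F"
    by standard (use distinct in \<open>auto simp: P_def\<close>)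
  define b where "b \<alpha> = (if \<alpha> \<in> \<Delta> then T else F)" for \<alpha>
  have b_in: "b \<alpha> \<in> P" and b_F: "b \<alpha> = F \<longleftrightarrow> \<alpha> \<notin> \<Delta>" for \<alpha>
    using distinct by (auto simp: b_def P_def)
  \<comment> \<open>The second coordinate is forced, since negation moves it to the first place.
    Excluded middle places the pair in \<open>swap_dom\<close>; the double negation clause yields
    the inequality required by \<open>ha_neg\<close>.\<close>
  define v where "v \<alpha> = (b \<alpha>, b (\<^bold>\<not> \<alpha>))" for \<alpha>
  have v_in: "v \<alpha> \<in> swap_dom P le" for \<alpha>
    using \<Delta>(1) b_in by (auto simp: swap_dom_eq v_def b_F bivaluation_def)
  have "valuation (swap_hyperalgebra P le himp) v"
    using \<Delta>(1) v_in b_in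
    by (simp add: valuation_def swap_hyperalgebra_def hjoin_eq hmeet_eq v_def b_F bivaluation_def)
  moreover have "v \<alpha> \<in> swap_designated P le \<longleftrightarrow> \<alpha> \<in> \<Delta>" for \<alpha>
    using v_in b_in b_F by (auto simp: swap_designated_def tops_eq v_def)
  ultimately show False
    using assms CIHL \<Delta>(2,3) unfolding HSW_entails_def nmatrix_entails_def by blast
qed

text \<open>Soundness holds over every infinite type, and the countermodels with three and two
  elements fit into every such type. Hence the two semantics can be compared over independent types
  \<open>'a\<close> and \<open>'b\<close>, via derivability.\<close>

theorem theorem6p6:
  fixes \<Gamma> :: "fm set" and \<phi> :: fm
  shows "(\<Gamma> \<turnstile>\<^sub>C \<phi> \<longleftrightarrow> HCmin_entails TYPE('a::infinite) \<Gamma> \<phi>) \<and>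
         (HCmin_entails TYPE('a) \<Gamma> \<phi> \<longleftrightarrow> HSW_entails TYPE('b::infinite) \<Gamma> \<phi>)"
  using HCmin_sound HCmin_complete HSW_sound HSW_complete by blast

end
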